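(* There exist inner functions $u$ and $v$ such that $u\notin\mathfrak I_c$ and $v\notin\mathfrak I_c$, but $uv\in\mathfrak I_c$.
   Context: $\mathbb D$ is the open unit disk in $\mathbb C$, and $H^\infty$ is the algebra of bounded holomorphic functions on $\mathbb D$. An inner function is a function $u\in H^\infty$ whose radial limits have modulus $1$ almost everywhere on the unit circle $\mathbb T$. For an inner function $u$ and $\eta\in\,]0,1[$ put $\Omega_u(\eta):=\{z\in\mathbb D: |u(z)|<\eta\}$. An inner function $u$ is called a one-component inner function if there is $\eta\in\,]0,1[$ such that $\Omega_u(\eta)$ is connected; unimodular constants are considered to be one-component inner functions. $\mathfrak I_c$ denotes the set of all one-component inner functions. *)

theory Defs
  imports "HOL-Complex_Analysis.Complex_Analysis"
begin

text \<open>
  Functions on the open unit disk are represented by total functions on \<open>complex\<close>;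
  their values outside \<open>ball 0 1\<close> are irrelevant to all notions below.
\<close>

definition Hinf :: "(complex \<Rightarrow> complex) set" where
  "Hinf = {f. f holomorphic_on ball 0 1 \<and> bounded (f ` ball 0 1)}"

definition has_radial_limit :: "(complex \<Rightarrow> complex) \<Rightarrow> real \<Rightarrow> complex \<Rightarrow> bool" where
  "has_radial_limit f t w \<longleftrightarrow> ((\<lambda>r. f (of_real r * cis t)) \<longlongrightarrow> w) (at_left (1::real))"

text \<open>
  The unit circle is parametrized by \<open>cis\<close> on \<open>{0..<2*pi}\<close>, so that null sets for arc length
  become Lebesgue null sets of angles.
\<close>

definition inner_function :: "(complex \<Rightarrow> complex) \<Rightarrow> bool" where
  "inner_function u \<longleftrightarrow> u \<in> Hinf \<and>
     (AE t in lebesgue_on {0..<2*pi}. \<exists>w. has_radial_limit u t w \<and> norm w = 1)"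

definition sublevel :: "(complex \<Rightarrow> complex) \<Rightarrow> real \<Rightarrow> complex set" where
  "sublevel u \<eta> = {z \<in> ball 0 1. norm (u z) < \<eta>}"

text \<open>
  The second disjunct is the convention that unimodular constants are one-component.
\<close>

definition one_component_inner :: "(complex \<Rightarrow> complex) set" where
  "one_component_inner = {u. inner_function u \<and>
     ((\<exists>\<eta>. 0 < \<eta> \<and> \<eta> < 1 \<and> connected (sublevel u \<eta>)) \<or>
      (\<exists>c. norm c = 1 \<and> (\<forall>z\<in>ball 0 1. u z = c)))}"

end

theory Submission imports Defs
begin

text \<open>
  In the right half-plane model of the disk, \<open>exp (- F)\<close> is inner when \<open>F\<close> is the Poisson-type
  sum \<open>\<Sum>k. 1 / (w - ik) + 1 / (w + ik)\<close> over a set \<open>A\<close> of natural numbers \<open>k\<close>,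
  and its sublevel sets are the superlevel sets of \<open>Re F\<close>. If \<open>A\<close> has gaps \<open>[N, M\<^sup>2 N)\<close>
  with \<open>M\<close> arbitrarily large, then \<open>F\<close> is \<open>O(1/M)\<close> on the semicircle \<open>\<bar>w\<bar> = MN\<close>,
  which therefore separates the superlevel set: it has points near each pole. The natural numbers
  can be split into two sets that both have such gaps. For the product the poles are
  all \<open>\<plusminus>ik\<close>; moving a point to the right keeps \<open>Re F\<close> above any level below \<open>1/4\<close>, so the
  superlevel set is a union of rays ending in a half-plane.
\<close>

section \<open>Splitting the natural numbers into two sets with wide gaps\<close>

definition wide_gaps :: "nat set \<Rightarrow> bool" where
  "wide_gaps A \<longleftrightarrow> (\<forall>M. \<exists>N\<ge>M. {N..<M * M * N} \<inter> A = {})"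

text \<open>The squared factorials \<open>a j\<close> cut the naturals into blocks whose endpoints
  have ratio \<open>(j + 1)^2\<close>, which eventually exceeds any \<open>M * M\<close>. Giving the
  blocks alternately to the two sets makes each block a gap of the set that does not own it.\<close>

lemma wide_gaps_partition: "\<exists>A. wide_gaps A \<and> wide_gaps (- A)"
proof -
  define a :: "nat \<Rightarrow> nat" where "a j = (fact j)^2" for j
  \<comment> \<open>\<open>L\<close> numbers the blocks, and its parity decides the owner.\<close>
  define L where "L k = (LEAST j. k < a j)" for k
  have a_mono: "a i \<le> a j" if "i \<le> j" for i j
    unfolding a_def using that by (intro power_mono fact_mono) auto
  have L_eq: "L k = Suc j" if "a j \<le> k" "k < a (Suc j)" for j k
    unfolding L_def
  proof (rule Least_equality)
    show "k < a (Suc j)" by fact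
    fix i assume "k < a i"
    then show "Suc j \<le> i"
      using that a_mono[of i j] by (meson not_less_eq_eq leD le_trans)
  qed
  have a_ge: "j \<le> a j" for j
  proof -
    have "j \<le> fact j" by (rule fact_ge_self)
    also have "\<dots> \<le> fact j ^ 2" by (rule self_le_power) auto
    finally show ?thesis by (simp add: a_def)
  qed
  have key: "\<exists>N\<ge>M. \<forall>k\<in>{N..<M * M * N}. L k = Suc j" if "M \<le> j" for M j
  proof (intro exI[of _ "a j"] conjI ballI)
    show "M \<le> a j" using that a_ge[of j] by simp
    fix k assume k: "k \<in> {a j..<M * M * a j}"
    have "M * M * a j \<le> Suc j * Suc j * a j"
      using that by (intro mult_mono) auto
    also have "\<dots> = a (Suc j)" by (simp add: a_def power2_eq_square algebra_simps)
    finally show "L k = Suc j" using k by (intro L_eq) auto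
  qed
  have "wide_gaps {k. odd (L k)}"
    unfolding wide_gaps_def
  proof
    fix M
    show "\<exists>N\<ge>M. {N..<M * M * N} \<inter> {k. odd (L k)} = {}"
      using key[of M "2 * M + 1"] by fastforce
  qed
  moreover have "wide_gaps (- {k. odd (L k)})"
    unfolding wide_gaps_def
  proof
    fix M
    show "\<exists>N\<ge>M. {N..<M * M * N} \<inter> - {k. odd (L k)} = {}"
      using key[of M "2 * M"] by fastforce
  qed
  ultimately show ?thesis by blast
qed

text \<open>A gap of the complement is an interval contained in \<open>A\<close>. Taking
  \<open>m + 2\<close> as gap parameter makes this interval nonempty and puts it beyond
  \<open>m\<close>.\<close>

lemma wide_gaps_Compl_unbounded:
  assumes "wide_gaps (- A)"
  shows "\<exists>k\<in>A. m < k"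
proof -
  obtain N where N: "N \<ge> m + 2" "{N..<(m + 2) * (m + 2) * N} \<inter> - A = {}"
    using assms unfolding wide_gaps_def by blast
  have "N * 1 < N * ((m + 2) * (m + 2))"
    using N(1) by (intro mult_strict_left_mono) auto
  then have "N \<in> {N..<(m + 2) * (m + 2) * N}" by (simp add: mult.commute)
  then show ?thesis using N by force
qed

section \<open>Convergence and holomorphy of the pole sums\<close>

text \<open>This is 1/(w - ik) + 1/(w + ik). Combining conjugate poles gives terms of order 1/k^2,
  hence absolute convergence. For \<open>k = 0\<close> the pole at 0 is counted twice.\<close>

definition pole_pair :: "nat \<Rightarrow> complex \<Rightarrow> complex" where
  "pole_pair k w = 2 * w / (w^2 + of_nat k ^ 2)"

definition pole_sum :: "nat set \<Rightarrow> complex \<Rightarrow> complex" where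
  "pole_sum A w = (\<Sum>k. if k \<in> A then pole_pair k w else 0)"

lemma pole_pair_denominator:
  "w^2 + of_nat k ^ 2 = (w - \<i> * of_nat k) * (w + \<i> * of_nat k)"
  by (simp add: algebra_simps power2_eq_square)

text \<open>Here \<open>norm w\<close> is at most \<open>k / 2\<close>, so \<open>k^2\<close>
  dominates the denominator. The bound depends on \<open>w\<close> only through \<open>R\<close>, as
  the M-test requires.\<close>

lemma norm_pole_pair_le_far:
  assumes "norm w \<le> R" "2 * R \<le> real k" "0 < k"
  shows "norm (pole_pair k w) \<le> 4 * R * (1 / real k ^ 2)"
proof -
  have R: "0 \<le> R" using assms(1) norm_ge_zero order_trans by blast
  have "norm w ^ 2 \<le> (real k / 2)^2"
    using assms by (intro power_mono) auto
  also have "\<dots> \<le> real k ^ 2 / 2" by (simp add: power2_eq_square)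
  finally have "norm (w^2) \<le> real k ^ 2 / 2" by (simp add: norm_power)
  moreover have "norm ((of_nat k :: complex)^2) - norm (w^2) \<le> norm (w^2 + of_nat k ^ 2)"
    by (metis add.commute norm_diff_ineq)
  ultimately have d: "real k ^ 2 / 2 \<le> norm (w^2 + of_nat k ^ 2)"
    by (simp add: norm_power)
  have "norm (pole_pair k w) = 2 * norm w / norm (w^2 + of_nat k ^ 2)"
    by (simp add: pole_pair_def norm_divide norm_mult)
  also have "\<dots> \<le> 2 * R / (real k ^ 2 / 2)"
    using assms R d by (intro frac_le) auto
  finally show ?thesis by simp
qed

text \<open>The opposite regime, in which \<open>w^2\<close> dominates the denominator; it will
  handle the poles below a gap.\<close>

lemma norm_pole_pair_le_near:
  assumes "2 * real k \<le> norm w" "w \<noteq> 0"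
  shows "norm (pole_pair k w) \<le> 4 / norm w"
proof -
  have "real k ^ 2 \<le> (norm w / 2)^2"
    using assms by (intro power_mono) auto
  also have "\<dots> \<le> norm w ^ 2 / 2" by (simp add: power2_eq_square)
  finally have "real k ^ 2 \<le> norm w ^ 2 / 2" .
  moreover have "norm (w^2) - norm ((of_nat k :: complex)^2) \<le> norm (w^2 + of_nat k ^ 2)"
    by (rule norm_diff_ineq)
  ultimately have d: "norm w ^ 2 / 2 \<le> norm (w^2 + of_nat k ^ 2)"
    by (simp add: norm_power)
  have "norm (pole_pair k w) = 2 * norm w / norm (w^2 + of_nat k ^ 2)"
    by (simp add: pole_pair_def norm_divide norm_mult)
  also have "\<dots> \<le> 2 * norm w / (norm w ^ 2 / 2)"
    using assms d by (intro divide_left_mono mult_pos_pos) (auto intro: less_le_trans[OF _ d])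
  also have "\<dots> = 4 / norm w" using assms by (simp add: power2_eq_square)
  finally show ?thesis .
qed

lemma summable_pole_sum: "summable (\<lambda>k. if k \<in> A then pole_pair k w else 0)"
proof (rule summable_comparison_test')
  show "summable (\<lambda>k. 4 * norm w * (1 / real k ^ 2))"
    by (intro summable_mult) (use inverse_power_summable[of 2, where 'a=real] in \<open>simp add: inverse_eq_divide\<close>)
  fix k assume "k \<ge> nat \<lceil>2 * norm w\<rceil> + 1"
  then have "2 * norm w \<le> real k" "0 < k" by linarith+
  then show "norm (if k \<in> A then pole_pair k w else 0) \<le> 4 * norm w * (1 / real k ^ 2)"
    using norm_pole_pair_le_far[of w "norm w" k] by auto
qed

text \<open>Only the terms with \<open>k\<close> at least \<open>2 * R\<close> need a majorant. The
  finitely many others do not affect uniform convergence, so poles inside the disk do no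
  harm.\<close>

lemma uniform_limit_pole_sum:
  "uniform_limit (cball 0 R) (\<lambda>n w. \<Sum>k<n. if k \<in> A then pole_pair k w else 0) (pole_sum A) sequentially"
  unfolding pole_sum_def
proof (rule Weierstrass_m_test_ev)
  show "summable (\<lambda>k. 4 * R * (1 / real k ^ 2))"
    by (intro summable_mult) (use inverse_power_summable[of 2, where 'a=real] in \<open>simp add: inverse_eq_divide\<close>)
  show "\<forall>\<^sub>F k in sequentially. \<forall>w\<in>cball 0 R.
          norm (if k \<in> A then pole_pair k w else 0) \<le> 4 * R * (1 / real k ^ 2)"
    using eventually_ge_at_top[of "nat \<lceil>2 * R\<rceil> + 1"]
  proof eventually_elim
    case (elim k)
    then have k: "2 * R \<le> real k" "0 < k" by linarith+
    show ?case
    proof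
      fix w :: complex assume w: "w \<in> cball 0 R"
      then have "norm w \<le> R" by simp
      then show "norm (if k \<in> A then pole_pair k w else 0) \<le> 4 * R * (1 / real k ^ 2)"
        using norm_pole_pair_le_far[of w R k] k order_trans[OF norm_ge_zero, of w R] by auto
    qed
  qed
qed

text \<open>The domain omits all points im with m an integer, whatever \<open>A\<close> is. It keeps
  the rest of the imaginary axis, where the boundary values are read off.\<close>

lemma holomorphic_pole_sum: "pole_sum A holomorphic_on {w. \<i> * w \<notin> \<int>}"
proof (rule holomorphic_uniform_sequence)
  have "{w. \<i> * w \<notin> \<int>} = (\<lambda>w. \<i> * w) -` (- \<int>)" by auto
  then show op: "open {w. \<i> * w \<notin> \<int>}"
    by (simp add: open_vimage open_Compl closed_Ints continuous_intros)
  show "(\<lambda>w. \<Sum>k<n. if k \<in> A then pole_pair k w else 0) holomorphic_on {w. \<i> * w \<notin> \<int>}" for n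
  proof (intro holomorphic_on_sum)
    fix k
    have nz: "w^2 + of_nat k ^ 2 \<noteq> 0" if "\<i> * w \<notin> \<int>" for w
    proof
      assume "w^2 + of_nat k ^ 2 = 0"
      then have "w = \<i> * of_nat k \<or> w = - (\<i> * of_nat k)"
        by (simp add: pole_pair_denominator eq_neg_iff_add_eq_0)
      then have "\<i> * w = - of_nat k \<or> \<i> * w = of_nat k"
        by (auto simp flip: mult.assoc)
      then show False using that by (metis Ints_minus Ints_of_nat)
    qed
    show "(\<lambda>w. if k \<in> A then pole_pair k w else 0) holomorphic_on {w. \<i> * w \<notin> \<int>}"
      unfolding pole_pair_def by (cases "k \<in> A") (auto intro!: holomorphic_intros simp: nz)
  qed
  fix w :: complex assume "w \<in> {w. \<i> * w \<notin> \<int>}"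
  with op obtain d where d: "0 < d" "cball w d \<subseteq> {w. \<i> * w \<notin> \<int>}"
    using open_contains_cball by blast
  have "cball w d \<subseteq> cball 0 (norm w + d)"
    by (simp add: cball_subset_cball_iff)
  then have "uniform_limit (cball w d)
      (\<lambda>n w. \<Sum>k<n. if k \<in> A then pole_pair k w else 0) (pole_sum A) sequentially"
    by (rule uniform_limit_on_subset[OF uniform_limit_pole_sum])
  with d show "\<exists>d>0. cball w d \<subseteq> {w. \<i> * w \<notin> \<int>} \<and> uniform_limit (cball w d)
      (\<lambda>n w. \<Sum>k<n. if k \<in> A then pole_pair k w else 0) (pole_sum A) sequentially"
    by blast
qed

lemma pole_sum_Compl: "pole_sum A w + pole_sum (- A) w = pole_sum UNIV w"
  unfolding pole_sum_def
  by (subst suminf_add[OF summable_pole_sum summable_pole_sum]) (auto intro!: suminf_cong)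

lemma Re_pole_sum: "Re (pole_sum A w) = (\<Sum>k. if k \<in> A then Re (pole_pair k w) else 0)"
  and summable_Re_pole_sum: "summable (\<lambda>k. if k \<in> A then Re (pole_pair k w) else 0)"
proof -
  have eq: "(\<lambda>k. Re (if k \<in> A then pole_pair k w else 0)) = (\<lambda>k. if k \<in> A then Re (pole_pair k w) else 0)"
    by auto
  show "Re (pole_sum A w) = (\<Sum>k. if k \<in> A then Re (pole_pair k w) else 0)"
    unfolding pole_sum_def Re_suminf[OF summable_pole_sum] eq ..
  show "summable (\<lambda>k. if k \<in> A then Re (pole_pair k w) else 0)"
    using summable_Re[OF summable_pole_sum[of A w]] by (simp add: eq)
qed

section \<open>Real parts through the Poisson kernel\<close>

text \<open>The real part of 1/(x + id): up to a constant factor, the Poisson kernel of the right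
  half-plane.\<close>

definition poisson :: "real \<Rightarrow> real \<Rightarrow> real" where
  "poisson x d = x / (x^2 + d^2)"

lemma poisson_nonneg: "0 \<le> x \<Longrightarrow> 0 \<le> poisson x d"
  by (simp add: poisson_def)

text \<open>For fixed \<open>d\<close> the kernel rises until \<open>x\<close> reaches the modulus
  of \<open>d\<close>: after cross-multiplication the difference is
  \<open>(t - x) * (d^2 - x * t)\<close>, with both factors nonnegative.\<close>

lemma poisson_mono:
  assumes "0 < x" "x \<le> t" "t \<le> \<bar>d\<bar>"
  shows "poisson x d \<le> poisson t d"
proof -
  have "x * t \<le> \<bar>d\<bar> * \<bar>d\<bar>" using assms by (intro mult_mono) auto
  then have "0 \<le> (t - x) * (d^2 - x * t)" using assms by (simp add: power2_eq_square)
  also have "\<dots> = t * (x^2 + d^2) - x * (t^2 + d^2)"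
    by (simp add: algebra_simps power2_eq_square)
  finally have "x * (t^2 + d^2) \<le> t * (x^2 + d^2)" by simp
  then show ?thesis using assms
    unfolding poisson_def by (subst frac_le_eq) (auto simp: add_pos_nonneg divide_le_0_iff sum_power2_eq_zero_iff)
qed

lemma poisson_ge:
  assumes "0 < t" "\<bar>d\<bar> \<le> t"
  shows "1 / (2 * t) \<le> poisson t d"
proof -
  have "d^2 \<le> t^2" using assms by (simp add: abs_le_square_iff[symmetric])
  then have "t / (2 * t^2) \<le> poisson t d"
    unfolding poisson_def using assms by (intro divide_left_mono) (auto intro!: mult_pos_pos add_pos_nonneg)
  then show ?thesis using assms by (simp add: power2_eq_square)
qed

lemma Re_inverse_Complex: "Re (1 / (Complex x y)) = poisson x y"
  by (simp add: poisson_def Re_divide)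

lemma Re_pole_pair:
  assumes "0 < x"
  shows "Re (pole_pair k (Complex x y)) = poisson x (y - real k) + poisson x (y + real k)"
proof -
  let ?w = "Complex x y"
  have eqs: "?w - \<i> * of_nat k = Complex x (y - real k)" "?w + \<i> * of_nat k = Complex x (y + real k)"
    by (auto simp: complex_eq_iff)
  have nz: "?w - \<i> * of_nat k \<noteq> 0" "?w + \<i> * of_nat k \<noteq> 0"
    unfolding eqs using assms by (auto simp: complex_eq_iff)
  have "pole_pair k ?w = 1 / (?w - \<i> * of_nat k) + 1 / (?w + \<i> * of_nat k)"
    unfolding pole_pair_def pole_pair_denominator using nz by (simp add: field_simps)
  then show ?thesis unfolding eqs by (simp add: Re_inverse_Complex del: complex_Re_of_nat)
qed

lemma Re_pole_pair_nonneg: "0 < Re w \<Longrightarrow> 0 \<le> Re (pole_pair k w)"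
  by (cases w) (simp add: Re_pole_pair poisson_nonneg)

text \<open>All terms have nonnegative real part, so any finitely many of them bound the sum from
  below.\<close>

lemma Re_pole_sum_ge:
  assumes "0 < Re w" "finite K" "K \<subseteq> A"
  shows "(\<Sum>k\<in>K. Re (pole_pair k w)) \<le> Re (pole_sum A w)"
proof -
  have "(\<Sum>k\<in>K. Re (pole_pair k w)) = (\<Sum>k\<in>K. if k \<in> A then Re (pole_pair k w) else 0)"
    using assms by (intro sum.cong) auto
  also have "\<dots> \<le> (\<Sum>k. if k \<in> A then Re (pole_pair k w) else 0)"
    using assms by (intro sum_le_suminf summable_Re_pole_sum) (auto simp: Re_pole_pair_nonneg)
  finally show ?thesis by (simp add: Re_pole_sum)
qed

lemma Re_pole_sum_nonneg: "0 < Re w \<Longrightarrow> 0 \<le> Re (pole_sum A w)"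
  using Re_pole_sum_ge[of w "{}" A] by simp

lemma Re_pole_sum_near_pole:
  assumes "k \<in> A" "0 < x"
  shows "1 / x \<le> Re (pole_sum A (Complex x (real k)))"
proof -
  have "1 / x = poisson x 0" using assms by (simp add: poisson_def power2_eq_square)
  also have "\<dots> \<le> Re (pole_pair k (Complex x (real k)))"
    using assms by (simp add: Re_pole_pair poisson_nonneg)
  also have "\<dots> \<le> Re (pole_sum A (Complex x (real k)))"
    using Re_pole_sum_ge[of "Complex x (real k)" "{k}" A] assms by simp
  finally show ?thesis .
qed

text \<open>Each term is purely imaginary there. At a pole, division by zero gives the value 0, so
  no point is exceptional.\<close>

lemma Re_pole_sum_imaginary: "Re (pole_sum A (\<i> * of_real y)) = 0"
proof -
  have "Re (pole_pair k (\<i> * of_real y)) = 0" for k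
  proof -
    have "pole_pair k (\<i> * of_real y) = \<i> * of_real (2 * y / (real k ^ 2 - y^2))"
      by (simp add: pole_pair_def power_mult_distrib)
    then show ?thesis by (simp only: Re_i_times Im_complex_of_real)
  qed
  then show ?thesis by (simp add: Re_pole_sum cong: if_cong)
qed

section \<open>Smallness in the middle of a gap, and disconnectedness\<close>

text \<open>Telescoping: 1/n^2 is at most 2/n - 2/(n + 1), because n + 1 is at most 2n.\<close>

lemma sum_inverse_squares_le:
  assumes "1 \<le> K"
  shows "(\<Sum>k\<in>{K..<n}. 1 / real k ^ 2) \<le> 2 / real K"
proof (cases "K \<le> n")
  case True
  then have "(\<Sum>k\<in>{K..<n}. 1 / real k ^ 2) \<le> 2 / real K - 2 / real n"
  proof (induction n rule: dec_induct)
    case (step n)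
    have "1 / real n ^ 2 \<le> 2 / real n - 2 / real (Suc n)"
    proof -
      have n: "1 \<le> real n" using step assms by simp
      then have "1 * real n \<le> real n * real n" by (intro mult_right_mono) auto
      then have "2 / (2 * real n ^ 2) \<le> 2 / (real n * (real n + 1))"
        using n by (intro divide_left_mono mult_pos_pos) (auto simp: power2_eq_square algebra_simps)
      then have "1 / real n ^ 2 \<le> 2 / (real n * (real n + 1))" by simp
      also have "\<dots> = 2 / real n - 2 / real (Suc n)"
        using n by (simp add: divide_simps)
      finally show ?thesis .
    qed
    then show ?case using step by simp
  qed simp
  then show ?thesis by (smt (verit) divide_nonneg_nonneg of_nat_0_le_iff)
qed simp

text \<open>The radius \<open>M * N\<close> is the geometric mean of the ends of the gap. The at
  most \<open>N\<close> indices below the gap contribute at most \<open>4 / (M * N)\<close> each,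
  together \<open>4 / M\<close>; the tail from \<open>M * M * N\<close> on contributes at most
  \<open>8 / M\<close>.\<close>

lemma norm_pole_sum_gap:
  assumes gap: "{N..<M * M * N} \<inter> A = {}" and M: "2 \<le> M" and N: "1 \<le> N"
    and w: "norm w = real (M * N)"
  shows "norm (pole_sum A w) \<le> 12 / real M"
proof (rule Lim_bounded)
  show "(\<lambda>n. norm (\<Sum>k<n. if k \<in> A then pole_pair k w else 0)) \<longlonglongrightarrow> norm (pole_sum A w)"
    unfolding pole_sum_def by (intro tendsto_norm summable_LIMSEQ summable_pole_sum)
  define R where "R = real (M * N)"
  define K where "K = M * M * N"
  have R: "0 < R" "real K = real M * R" using M N by (auto simp: R_def K_def)
  have K: "1 \<le> K" using M N by (simp add: K_def)
  have "norm (\<Sum>k<n. if k \<in> A then pole_pair k w else 0) \<le> 12 / real M" for n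
  proof -
    have "norm (\<Sum>k<n. if k \<in> A then pole_pair k w else 0)
        \<le> (\<Sum>k<n. (if k \<in> {..<N} then 4 / R else 0) + (if k \<in> {K..<n} then 4 * R * (1 / real k ^ 2) else 0))"
    proof (rule sum_norm_le)
      fix k assume k: "k \<in> {..<n}"
      consider "k \<notin> A" | "k \<in> A" "k < N" | "k \<in> A" "K \<le> k"
      proof -
        have "k \<notin> A \<or> k < N \<or> K \<le> k"
          using gap unfolding K_def by (meson atLeastLessThan_iff disjoint_iff not_le)
        then show thesis using that by blast
      qed
      then show "norm (if k \<in> A then pole_pair k w else 0)
        \<le> (if k \<in> {..<N} then 4 / R else 0) + (if k \<in> {K..<n} then 4 * R * (1 / real k ^ 2) else 0)"
      proof cases
        case 1
        then show ?thesis using R by simp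
      next
        case 2
        have "2 * k \<le> M * N" using 2 M by (intro mult_mono) auto
        then have "2 * real k \<le> norm w" unfolding w by linarith
        then have "norm (pole_pair k w) \<le> 4 / R"
          using norm_pole_pair_le_near[of k w] R(1) w unfolding R_def by force
        moreover have "0 \<le> 4 * R / real k ^ 2" using R by simp
        ultimately show ?thesis using 2 by auto
      next
        case 3
        have "2 * R \<le> real M * R" using M R by (intro mult_right_mono) auto
        then have "2 * R \<le> real k" using 3 R by linarith
        then have "norm (pole_pair k w) \<le> 4 * R * (1 / real k ^ 2)"
          using 3 K w by (intro norm_pole_pair_le_far) (auto simp: R_def)
        then show ?thesis using 3 R k by (auto intro!: add_increasing)
      qed
    qed
    also have "\<dots> = (\<Sum>k\<in>{..<n} \<inter> {..<N}. 4 / R) + 4 * R * (\<Sum>k\<in>{..<n} \<inter> {K..<n}. 1 / real k ^ 2)"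
      unfolding sum.distrib sum_distrib_left by (simp only: sum.inter_restrict[OF finite_lessThan])
    also have "{..<n} \<inter> {K..<n} = {K..<n}" by auto
    also have "(\<Sum>k\<in>{..<n} \<inter> {..<N}. 4 / R) \<le> (\<Sum>k\<in>{..<N}. 4 / R)"
      using R by (intro sum_mono2) auto
    also have "\<dots> = 4 / real M" using M N by (simp add: R_def)
    also have "4 * R * (\<Sum>k\<in>{K..<n}. 1 / real k ^ 2) \<le> 4 * R * (2 / real K)"
      using R K by (intro mult_left_mono sum_inverse_squares_le) auto
    also have "\<dots> = 8 / real M" using R by simp
    finally show ?thesis by simp
  qed
  then show "\<forall>n\<ge>0. norm (\<Sum>k<n. if k \<in> A then pole_pair k w else 0) \<le> 12 / real M" by blast
qed

text \<open>The norm maps a connected set onto an interval. Poles inside and outside a gap circle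
  give points of the set on either side, while on the circle itself the real part stays below
  \<open>c\<close>.\<close>

lemma disconnected_superlevel:
  assumes gaps: "wide_gaps A" "wide_gaps (- A)" and c: "0 < c"
  shows "\<not> connected {w. 0 < Re w \<and> c < Re (pole_sum A w)}"
proof
  assume conn: "connected {w. 0 < Re w \<and> c < Re (pole_sum A w)}" (is "connected ?S")
  obtain k1 where k1: "k1 \<in> A" using wide_gaps_Compl_unbounded[OF gaps(2)] by blast
  \<comment> \<open>Beyond \<open>12 / c\<close> the bound on the circle drops below
    \<open>c\<close>; the summand \<open>k1 + 2\<close> leaves room for a point near the pole of
    index \<open>k1\<close> inside the circle.\<close>
  define M where "M = k1 + 2 + nat \<lceil>12 / c\<rceil>"
  obtain N where N: "M \<le> N" "{N..<M * M * N} \<inter> A = {}"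
    using gaps(1) unfolding wide_gaps_def by blast
  obtain k2 where k2: "k2 \<in> A" "M * N < k2" using wide_gaps_Compl_unbounded[OF gaps(2)] by blast
  have M: "2 \<le> M" "k1 + 2 \<le> M" "12 / c < real M" unfolding M_def by linarith+
  have small: "norm (pole_sum A w) < c" if "norm w = real (M * N)" for w
  proof -
    have "norm (pole_sum A w) \<le> 12 / real M"
      using norm_pole_sum_gap[OF N(2)] M N that by simp
    also have "\<dots> < c" using M(1,3) c by (simp add: field_simps)
    finally show ?thesis .
  qed
  \<comment> \<open>Small enough that \<open>1 / x\<close> exceeds \<open>c\<close>, and below 1 so
    that the point at height \<open>k1\<close> stays inside the circle.\<close>
  define x where "x = 1 / (c + 2)"
  have x: "0 < x" "x < 1" "c < 1 / x" using c by (auto simp: x_def)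
  have in_S: "Complex x (real k) \<in> ?S" if "k \<in> A" for k
    using Re_pole_sum_near_pole[OF that x(1)] x by auto
  have "1 * N \<le> M * N" using M by (intro mult_right_mono) auto
  then have "k1 + 1 < M * N" using M N by linarith
  moreover have "norm (Complex x (real k1)) \<le> x + real k1"
    using cmod_le[of "Complex x (real k1)"] x by simp
  ultimately have w1: "norm (Complex x (real k1)) < real (M * N)" using x by linarith
  have "real k2 \<le> norm (Complex x (real k2))"
    using abs_Im_le_cmod[of "Complex x (real k2)"] by simp
  then have w2: "norm (Complex x (real k2)) > real (M * N)" using k2 by linarith
  have "connected (norm ` ?S)"
    using conn by (intro connected_continuous_image continuous_intros)
  moreover have "norm (Complex x (real k1)) \<in> norm ` ?S" "norm (Complex x (real k2)) \<in> norm ` ?S"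
    using in_S k1 k2 by blast+
  ultimately have "real (M * N) \<in> norm ` ?S"
    using w1 w2 by (meson connected_iff_interval less_imp_le)
  then obtain w where "w \<in> ?S" "norm w = real (M * N)" by force
  then show False using small[of w] complex_Re_le_cmod[of "pole_sum A w"] by auto
qed

section \<open>Connectedness when all poles are present\<close>

text \<open>There are \<open>floor t\<close> consecutive poles within vertical distance
  \<open>t\<close>, each contributing at least \<open>1 / (2 * t)\<close>, and
  \<open>floor t\<close> is at least \<open>t / 2\<close>.\<close>

lemma Re_pole_sum_UNIV_ge_far:
  assumes "1 \<le> t"
  shows "1 / 4 \<le> Re (pole_sum UNIV (Complex t y))"
proof -
  define K where "K = {nat \<lceil>\<bar>y\<bar>\<rceil>..<nat \<lceil>\<bar>y\<bar>\<rceil> + nat \<lfloor>t\<rfloor>}"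
  have "1 / 4 = (t / 2) * (1 / (2 * t))" using assms by simp
  also have "\<dots> \<le> real (card K) * (1 / (2 * t))"
  proof (rule mult_right_mono)
    have "1 \<le> real_of_int \<lfloor>t\<rfloor>" using assms by simp
    moreover have "real (card K) = real_of_int \<lfloor>t\<rfloor>" using assms by (simp add: K_def)
    ultimately show "t / 2 \<le> real (card K)" using floor_correct[of t] by linarith
  qed (use assms in simp)
  also have "\<dots> = (\<Sum>k\<in>K. 1 / (2 * t))" by simp
  also have "\<dots> \<le> (\<Sum>k\<in>K. Re (pole_pair k (Complex t y)))"
  proof (rule sum_mono)
    fix k assume "k \<in> K"
    then have "\<bar>\<bar>y\<bar> - real k\<bar> \<le> t" using assms unfolding K_def by simp linarith
    \<comment> \<open>The sign of \<open>y\<close> decides which of the two conjugate poles is the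
      near one.\<close>
    then have "\<bar>y - real k\<bar> \<le> t \<or> \<bar>y + real k\<bar> \<le> t" by linarith
    then have "1 / (2 * t) \<le> poisson t (y - real k) \<or> 1 / (2 * t) \<le> poisson t (y + real k)"
      using poisson_ge assms by force
    then show "1 / (2 * t) \<le> Re (pole_pair k (Complex t y))"
      using poisson_nonneg[of t "y - real k"] poisson_nonneg[of t "y + real k"] assms
      by (auto simp: Re_pole_pair)
  qed
  also have "\<dots> \<le> Re (pole_sum UNIV (Complex t y))"
    using assms by (intro Re_pole_sum_ge) (auto simp: K_def)
  finally show ?thesis .
qed

text \<open>Let \<open>D\<close> be the distance from \<open>y\<close> to the nearest integer. Up to
  abscissa \<open>D\<close> every term increases; between \<open>D\<close> and 1 the nearest pole
  alone gives at least 1/2; from 1 on the previous bound gives 1/4.\<close>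

lemma Re_pole_sum_UNIV_right:
  assumes "0 < x" "x \<le> t" "c < 1 / 4" "c < Re (pole_sum UNIV (Complex x y))"
  shows "c < Re (pole_sum UNIV (Complex t y))"
proof -
  define D where "D = \<bar>y - of_int (round y)\<bar>"
  consider "1 \<le> t" | "t < 1" "D \<le> t" | "t \<le> D" by linarith
  then show ?thesis
  proof cases
    case 1
    then show ?thesis using Re_pole_sum_UNIV_ge_far[of t y] assms by linarith
  next
    case 2
    define k where "k = nat \<bar>round y\<bar>"
    have "\<bar>y - real k\<bar> = D \<or> \<bar>y + real k\<bar> = D" by (auto simp: D_def k_def abs_if)
    then have "1 / (2 * t) \<le> poisson t (y - real k) \<or> 1 / (2 * t) \<le> poisson t (y + real k)"
      using poisson_ge[of t "y - real k"] poisson_ge[of t "y + real k"] 2 assms by force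
    then have "1 / (2 * t) \<le> Re (pole_pair k (Complex t y))"
      using poisson_nonneg[of t "y - real k"] poisson_nonneg[of t "y + real k"] assms
      by (auto simp: Re_pole_pair)
    also have "\<dots> \<le> Re (pole_sum UNIV (Complex t y))"
      using Re_pole_sum_ge[of "Complex t y" "{k}" UNIV] assms by simp
    finally have "1 / (2 * t) \<le> Re (pole_sum UNIV (Complex t y))" .
    moreover have "1 / 2 \<le> 1 / (2 * t)" using 2 assms by (intro divide_left_mono) auto
    ultimately show ?thesis using assms by linarith
  next
    case 3
    have "Re (pole_pair k (Complex x y)) \<le> Re (pole_pair k (Complex t y))" for k
    proof -
      have "D \<le> \<bar>y - real k\<bar>" "D \<le> \<bar>y + real k\<bar>"
        using round_diff_minimal[of y "int k"] round_diff_minimal[of y "- int k"] by (auto simp: D_def)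
      then show ?thesis
        using 3 assms by (auto simp: Re_pole_pair intro!: add_mono poisson_mono)
    qed
    then have "Re (pole_sum UNIV (Complex x y)) \<le> Re (pole_sum UNIV (Complex t y))"
      unfolding Re_pole_sum by (intro suminf_le summable_Re_pole_sum) auto
    then show ?thesis using assms by linarith
  qed
qed

text \<open>Rightward rays stay in the set and reach the half-plane \<open>H\<close>, which lies in
  the set because \<open>c < 1 / 4\<close>. All pieces of the union share \<open>H\<close>.\<close>

lemma connected_superlevel_UNIV:
  assumes "c < 1 / 4"
  shows "connected {w. 0 < Re w \<and> c < Re (pole_sum UNIV w)}" (is "connected ?S")
proof -
  define H where "H = {w. 1 \<le> Re w}"
  have H: "H \<subseteq> ?S"
  proof
    fix w assume "w \<in> H"
    then show "w \<in> ?S" using Re_pole_sum_UNIV_ge_far[of "Re w" "Im w"] assms by (auto simp: H_def)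
  qed
  have connH: "connected H" unfolding H_def
    by (intro convex_connected convex_halfspace_Re_ge)
  define ray where "ray w = (\<lambda>t. Complex t (Im w)) ` {Re w..}" for w
  have ray_S: "ray w \<subseteq> ?S" if "w \<in> ?S" for w
  proof
    fix z assume "z \<in> ray w"
    then obtain t where "z = Complex t (Im w)" "Re w \<le> t" by (auto simp: ray_def)
    then show "z \<in> ?S" using that Re_pole_sum_UNIV_right[of "Re w" t c "Im w"] assms by auto
  qed
  have conn_ray: "connected (ray w)" for w
    unfolding ray_def Complex_eq by (intro connected_continuous_image continuous_intros) auto
  have "?S = (\<Union>w\<in>?S. H \<union> ray w)"
  proof
    show "?S \<subseteq> (\<Union>w\<in>?S. H \<union> ray w)"
      by (force simp: ray_def)
  qed (use H ray_S in blast)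
  moreover have "connected (\<Union>w\<in>?S. H \<union> ray w)"
  proof (rule connected_Union)
    have "connected (H \<union> ray w)" for w
    proof (rule connected_Un[OF connH conn_ray])
      have "Complex (max 1 (Re w)) (Im w) \<in> H \<inter> ray w" by (auto simp: H_def ray_def)
      then show "H \<inter> ray w \<noteq> {}" by blast
    qed
    then show "connected s" if "s \<in> (\<lambda>w. H \<union> ray w) ` ?S" for s using that by auto
    have "1 \<in> H" by (simp add: H_def)
    then show "\<Inter> ((\<lambda>w. H \<union> ray w) ` ?S) \<noteq> {}" by blast
  qed
  ultimately show ?thesis by simp
qed

section \<open>Transfer to the disk by the Cayley transform\<close>

definition cayley :: "complex \<Rightarrow> complex" where
  "cayley z = (1 + z) / (1 - z)"

definition cayley_inv :: "complex \<Rightarrow> complex" where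
  "cayley_inv w = (w - 1) / (w + 1)"

lemma cayley_inv_cayley: "z \<noteq> 1 \<Longrightarrow> cayley_inv (cayley z) = z"
  by (simp add: cayley_def cayley_inv_def field_simps)

lemma cayley_cayley_inv:
  assumes "w \<noteq> -1"
  shows "cayley (cayley_inv w) = w"
proof -
  have nz: "w + 1 \<noteq> 0" using assms by (simp add: eq_neg_iff_add_eq_0)
  then have "1 + cayley_inv w = 2 * w / (w + 1)" "1 - cayley_inv w = 2 / (w + 1)"
    by (simp_all add: cayley_inv_def field_simps)
  then show ?thesis using nz by (simp add: cayley_def)
qed

text \<open>Serves twice: the numerator is positive in the disk and zero on the circle.\<close>

lemma Re_cayley: "Re (cayley z) = (1 - norm z ^ 2) / norm (1 - z) ^ 2"
  unfolding cayley_def Re_divide cmod_power2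
  by (simp add: algebra_simps power2_eq_square)

lemma Re_cayley_pos: "norm z < 1 \<Longrightarrow> 0 < Re (cayley z)"
  by (auto simp: Re_cayley abs_square_less_1 intro!: divide_pos_pos)

lemma norm_cayley_inv:
  assumes "0 < Re w"
  shows "norm (cayley_inv w) < 1"
proof -
  have nz: "w + 1 \<noteq> 0" using assms by (auto simp: complex_eq_iff)
  have "norm (w - 1) ^ 2 < norm (w + 1) ^ 2"
    unfolding cmod_power2 using assms by (simp add: power2_eq_square algebra_simps)
  then have "norm (w - 1) < norm (w + 1)" by (rule power_less_imp_less_base) simp
  then show ?thesis using nz by (simp add: cayley_inv_def norm_divide)
qed

text \<open>Up to a unimodular constant, the singular inner function of an atomic measure with atoms
  at the images under \<open>cayley_inv\<close> of the poles.\<close>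

definition singular_inner :: "nat set \<Rightarrow> complex \<Rightarrow> complex" where
  "singular_inner A z = exp (- pole_sum A (cayley z))"

lemma norm_singular_inner: "norm (singular_inner A z) = exp (- Re (pole_sum A (cayley z)))"
  by (simp add: singular_inner_def)

lemma isCont_singular_inner:
  assumes "z \<noteq> 1" "\<i> * cayley z \<notin> \<int>"
  shows "isCont (singular_inner A) z"
proof -
  have "{w. \<i> * w \<notin> \<int>} = (\<lambda>w. \<i> * w) -` (- \<int>)" by auto
  then have "open {w. \<i> * w \<notin> \<int>}"
    by (simp add: open_vimage open_Compl closed_Ints continuous_intros)
  then have "isCont (pole_sum A) (cayley z)"
    using holomorphic_on_imp_continuous_on[OF holomorphic_pole_sum] assms
    by (simp add: continuous_on_eq_continuous_at)
  moreover have "isCont cayley z"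
    unfolding cayley_def using assms by (intro continuous_intros) auto
  ultimately have "isCont (\<lambda>z. pole_sum A (cayley z)) z" by (rule isCont_o2[rotated])
  then show ?thesis unfolding singular_inner_def by (intro continuous_intros)
qed

text \<open>Off a countable set of boundary points the function is continuous, so the radial limit
  is its value there, of modulus 1 because the exponent is purely imaginary. Boundedness comes from
  the sign of the real part.\<close>

lemma inner_singular_inner: "inner_function (singular_inner A)"
  unfolding inner_function_def
proof
  have "cayley holomorphic_on ball 0 1"
    unfolding cayley_def by (intro holomorphic_intros) auto
  moreover have "cayley ` ball 0 1 \<subseteq> {w. \<i> * w \<notin> \<int>}"
    using Re_cayley_pos by (force simp: Ints_def complex_eq_iff)
  ultimately have "(pole_sum A \<circ> cayley) holomorphic_on ball 0 1"
    using holomorphic_on_compose_gen holomorphic_pole_sum by blast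
  then have "(\<lambda>z. exp (- (pole_sum A \<circ> cayley) z)) holomorphic_on ball 0 1"
    by (intro holomorphic_intros)
  moreover have "bounded (singular_inner A ` ball 0 1)"
    by (rule boundedI[of _ 1])
       (auto simp: norm_singular_inner Re_pole_sum_nonneg Re_cayley_pos)
  ultimately show "singular_inner A \<in> Hinf"
    by (simp add: Hinf_def singular_inner_def[abs_def] o_def)
next
  \<comment> \<open>The point 1, which corresponds to infinity, and the preimages of all possible
    poles.\<close>
  define E where "E = insert 1 ((\<lambda>m. cayley_inv (- \<i> * m)) ` \<int>)"
  have "countable E" unfolding E_def by (intro countable_insert countable_image countable_int)
  \<comment> \<open>\<open>Arg2pi\<close> recovers the angle of a point of the circle, so countably
    many points exclude only a null set of angles.\<close>
  then have "Arg2pi ` E \<in> null_sets lebesgue"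
    by (intro null_sets_completionI countable_imp_null_set_lborel) auto
  then have "AE t in lebesgue. t \<notin> Arg2pi ` E" by (rule AE_not_in)
  then have "AE t in lebesgue. t \<in> {0..<2*pi} \<longrightarrow>
      (\<exists>w. has_radial_limit (singular_inner A) t w \<and> norm w = 1)"
  proof eventually_elim
    case (elim t)
    show ?case
    proof
      assume t: "t \<in> {0..<2*pi}"
      define z where "z = cis t"
      have "Arg2pi z = t"
        using t by (intro Arg2pi_unique[of 1]) (auto simp: z_def cis_conv_exp)
      then have "z \<notin> E" using elim by blast
      then have z1: "z \<noteq> 1" by (auto simp: E_def)
      have z2: "\<i> * cayley z \<notin> \<int>"
      proof
        assume "\<i> * cayley z \<in> \<int>"
        then have "cayley_inv (- \<i> * (\<i> * cayley z)) \<in> E" unfolding E_def by blast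
        then show False using \<open>z \<notin> E\<close> z1 by (simp add: cayley_inv_cayley flip: mult.assoc)
      qed
      have "Re (cayley z) = 0" by (simp add: Re_cayley z_def)
      then have "cayley z = \<i> * of_real (Im (cayley z))" by (simp add: complex_eq_iff)
      then have "norm (singular_inner A z) = 1"
        by (metis norm_singular_inner Re_pole_sum_imaginary minus_zero exp_zero)
      moreover have "((\<lambda>r. singular_inner A (of_real r * cis t)) \<longlongrightarrow> singular_inner A z) (at_left 1)"
      proof (rule isCont_tendsto_compose[OF isCont_singular_inner[OF z1 z2]])
        have "((\<lambda>r. of_real r * cis t) \<longlongrightarrow> of_real 1 * cis t) (at_left 1)"
          by (intro tendsto_intros)
        then show "((\<lambda>r. of_real r * cis t) \<longlongrightarrow> z) (at_left 1)" by (simp add: z_def)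
      qed
      ultimately show "\<exists>w. has_radial_limit (singular_inner A) t w \<and> norm w = 1"
        by (auto simp: has_radial_limit_def)
    qed
  qed
  then show "AE t in lebesgue_on {0..<2*pi}. \<exists>w. has_radial_limit (singular_inner A) t w \<and> norm w = 1"
    by (subst AE_restrict_space_iff) auto
qed

lemma sublevel_singular_inner:
  assumes "0 < \<eta>"
  shows "z \<in> sublevel (singular_inner A) \<eta> \<longleftrightarrow> norm z < 1 \<and> - ln \<eta> < Re (pole_sum A (cayley z))"
proof -
  have "exp (- Re (pole_sum A (cayley z))) < \<eta> \<longleftrightarrow> - Re (pole_sum A (cayley z)) < ln \<eta>"
    using assms by (metis exp_less_cancel_iff exp_ln)
  then show ?thesis by (auto simp: sublevel_def norm_singular_inner)
qed

text \<open>\<open>cayley\<close> restricts to a homeomorphism between the two sets, so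
  connectedness passes both ways.\<close>

lemma connected_sublevel_singular_inner:
  assumes "0 < \<eta>"
  shows "connected (sublevel (singular_inner A) \<eta>) \<longleftrightarrow>
    connected {w. 0 < Re w \<and> - ln \<eta> < Re (pole_sum A w)}" (is "connected ?L \<longleftrightarrow> connected ?S")
proof
  have ne: "w \<noteq> -1" if "w \<in> ?S" for w using that by auto
  have "cayley ` ?L = ?S"
  proof
    show "cayley ` ?L \<subseteq> ?S" using assms by (auto simp: sublevel_singular_inner Re_cayley_pos)
    show "?S \<subseteq> cayley ` ?L"
    proof
      fix w assume w: "w \<in> ?S"
      then have "cayley_inv w \<in> ?L"
        using assms ne[OF w] by (simp add: sublevel_singular_inner norm_cayley_inv cayley_cayley_inv)
      then show "w \<in> cayley ` ?L" using cayley_cayley_inv[OF ne[OF w]] by force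
    qed
  qed
  moreover have "continuous_on ?L cayley"
    unfolding cayley_def by (intro continuous_intros) (auto simp: sublevel_def)
  ultimately show "connected ?S" if "connected ?L" using that connected_continuous_image by metis
  have "cayley_inv ` ?S = ?L"
  proof -
    have "cayley_inv (cayley z) = z" if "z \<in> ?L" for z
      using that by (intro cayley_inv_cayley) (auto simp: sublevel_def)
    then have "cayley_inv ` (cayley ` ?L) = ?L"
      by (simp add: image_image)
    then show ?thesis by (simp only: \<open>cayley ` ?L = ?S\<close>)
  qed
  moreover have "continuous_on ?S cayley_inv"
    unfolding cayley_inv_def using ne by (intro continuous_intros) (auto simp: add_eq_0_iff2)
  ultimately show "connected ?L" if "connected ?S" using that connected_continuous_image by metis
qed

section \<open>The two factors and their product\<close>

lemma singular_inner_not_one_component: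
  assumes "wide_gaps A" "wide_gaps (- A)"
  shows "singular_inner A \<notin> one_component_inner"
proof
  assume "singular_inner A \<in> one_component_inner"
  then consider \<eta> where "0 < \<eta>" "\<eta> < 1" "connected (sublevel (singular_inner A) \<eta>)"
    | c where "norm c = 1" "\<forall>z\<in>ball 0 1. singular_inner A z = c"
    unfolding one_component_inner_def by blast
  then show False
  proof cases
    case 1
    then show ?thesis
      using disconnected_superlevel[OF assms, of "- ln \<eta>"] by (simp add: connected_sublevel_singular_inner)
  next
    case 2
    \<comment> \<open>Unimodular constants are excluded at the point 1 + ik: the real part of the
      sum is at least 1 there, so the modulus is below 1.\<close>
    obtain k where "k \<in> A" using wide_gaps_Compl_unbounded[OF assms(2)] by blast
    let ?w = "Complex 1 (real k)"
    have "cayley_inv ?w \<in> ball 0 1" by (simp add: norm_cayley_inv)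
    then have "norm (singular_inner A (cayley_inv ?w)) = 1" using 2 by metis
    moreover have "?w \<noteq> -1" by (simp add: complex_eq_iff)
    ultimately show ?thesis
      using Re_pole_sum_near_pole[OF \<open>k \<in> A\<close>, of 1] by (simp add: norm_singular_inner cayley_cayley_inv)
  qed
qed

lemma singular_inner_UNIV_one_component: "singular_inner UNIV \<in> one_component_inner"
proof -
  \<comment> \<open>This level corresponds to the threshold 1/8, which is below 1/4.\<close>
  have "connected (sublevel (singular_inner UNIV) (exp (- 1 / 8)))"
    using connected_superlevel_UNIV[of "1 / 8"] by (simp add: connected_sublevel_singular_inner)
  then show ?thesis unfolding one_component_inner_def
    using inner_singular_inner[of UNIV] by (auto intro!: exI[of _ "exp (- 1 / 8) :: real"])
qed

theorem mainTheorem4: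
  "\<exists>u v. inner_function u \<and> inner_function v \<and>
     u \<notin> one_component_inner \<and> v \<notin> one_component_inner \<and>
     (\<lambda>z. u z * v z) \<in> one_component_inner"
proof -
  obtain A where A: "wide_gaps A" "wide_gaps (- A)" using wide_gaps_partition by blast
  \<comment> \<open>The sums over \<open>A\<close> and its complement add up to the full sum, so the
    exponentials multiply.\<close>
  have "(\<lambda>z. singular_inner A z * singular_inner (- A) z) = singular_inner UNIV"
    by (auto simp: singular_inner_def pole_sum_Compl[of A, symmetric] simp flip: exp_add)
  then show ?thesis
    using A singular_inner_not_one_component[of A] singular_inner_not_one_component[of "- A"]
      inner_singular_inner singular_inner_UNIV_one_component
    by (intro exI[of _ "singular_inner A"] exI[of _ "singular_inner (- A)"]) simp
qed

end
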